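(* Let $L$ be a primitive Gaussian line, with associated Gaussian integers $\alpha_0=a+bi$ and $\delta=c+di$, and let $\Delta=ad-bc$. Let $r\in\mathbb{Z}$. Then $r$ is in the rational set $\mathcal{R}(L)$ of $L$ if and only if $r$ divides $\Delta$.
   Context: A Gaussian line is a line in the complex plane containing at least two (hence infinitely many) elements of $\mathbb{Z}[i]$. It is primitive if the Gaussian integers on it do not all share a common non-unit divisor in $\mathbb{Z}[i]$. For a Gaussian line $L$, $\alpha_0=a+bi$ denotes the Gaussian integer on $L$ of minimum norm $N(x+iy)=x^2+y^2$ (if there are two, the one with larger real part). If $L$ is vertical, $\delta=i$; otherwise $\delta=c+di=\alpha_1-\alpha_0$, where $\alpha_1$ is the Gaussian integer on $L$ closest to $\alpha_0$ with $\mathrm{Re}(\alpha_1)>\mathrm{Re}(\alpha_0)$. Then the Gaussian integers on $L$ are exactly $\alpha_n=\alpha_0+\delta n$, $n\in\mathbb{Z}$. The rational set of $L$ is $\mathcal{R}(L)=\{r\in\mathbb{Z}: r\mid\alpha_n\text{ in }\mathbb{Z}[i]\text{ for some }n\in\mathbb{Z}\}$. *)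

theory Defs
  imports "HOL-Analysis.Analysis"
begin

text \<open>Gaussian integers are represented inside the type of complex numbers.\<close>

definition gauss_ints :: "complex set" where
  "gauss_ints = {z. Re z \<in> \<int> \<and> Im z \<in> \<int>}"

text \<open>Divisibility and units are taken in the ring of Gaussian integers: the
  class operation \<open>dvd\<close> on type \<open>complex\<close> would be divisibility in a field.\<close>

definition gauss_dvd :: "complex \<Rightarrow> complex \<Rightarrow> bool" where
  "gauss_dvd x y \<longleftrightarrow> (\<exists>q\<in>gauss_ints. y = x * q)"

definition gauss_unit :: "complex \<Rightarrow> bool" where
  "gauss_unit u \<longleftrightarrow> u \<in> gauss_ints \<and> gauss_dvd u 1"

definition gauss_norm :: "complex \<Rightarrow> real" where
  "gauss_norm z = (Re z)\<^sup>2 + (Im z)\<^sup>2"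

definition gaussian_line :: "complex set \<Rightarrow> bool" where
  "gaussian_line L \<longleftrightarrow> affine L \<and> aff_dim L = 1 \<and>
     (\<exists>z \<in> L \<inter> gauss_ints. \<exists>w \<in> L \<inter> gauss_ints. z \<noteq> w)"

definition primitive_line :: "complex set \<Rightarrow> bool" where
  "primitive_line L \<longleftrightarrow> gaussian_line L \<and>
     \<not> (\<exists>g\<in>gauss_ints. \<not> gauss_unit g \<and> (\<forall>z \<in> L \<inter> gauss_ints. gauss_dvd g z))"

definition vertical_line :: "complex set \<Rightarrow> bool" where
  "vertical_line L \<longleftrightarrow> (\<forall>z\<in>L. \<forall>w\<in>L. Re z = Re w)"

text \<open>The descriptions below denote uniquely whenever \<open>L\<close> is a Gaussian line
  (for \<open>alpha1\<close>: a non-vertical one). Two distinct minimizers of the norm on \<open>L\<close>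
  with equal real part would be conjugate, and then the real point between them
  would be a Gaussian integer on \<open>L\<close> of smaller norm.\<close>

definition alpha0 :: "complex set \<Rightarrow> complex" where
  "alpha0 L = (THE z. is_arg_min gauss_norm (\<lambda>w. w \<in> L \<inter> gauss_ints) z \<and>
     (\<forall>w. is_arg_min gauss_norm (\<lambda>w. w \<in> L \<inter> gauss_ints) w \<longrightarrow> Re w \<le> Re z))"

definition alpha1 :: "complex set \<Rightarrow> complex" where
  "alpha1 L = (THE z. is_arg_min (\<lambda>w. dist w (alpha0 L))
     (\<lambda>w. w \<in> L \<inter> gauss_ints \<and> Re w > Re (alpha0 L)) z)"

definition delta :: "complex set \<Rightarrow> complex" where
  "delta L = (if vertical_line L then \<i> else alpha1 L - alpha0 L)"

definition alpha :: "complex set \<Rightarrow> int \<Rightarrow> complex" where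
  "alpha L n = alpha0 L + delta L * of_int n"

definition rational_set :: "complex set \<Rightarrow> int set" where
  "rational_set L = {r. \<exists>n. gauss_dvd (of_int r) (alpha L n)}"

end

theory Submission imports Defs begin

text \<open>
  The step \<open>\<delta> = c + di\<close> from \<open>\<alpha>\<^sub>0\<close> to the next Gaussian integer on a non-vertical line has
  coprime coordinates, since otherwise \<open>\<alpha>\<^sub>0 + \<delta> / gcd(c, d)\<close> would be a closer one; for a vertical
  line \<open>\<delta> = i\<close>. If \<open>uc + vd = 1\<close> and \<open>n = -(ua + vb)\<close>, then \<open>\<alpha>\<^sub>0 + \<delta>n = (v - ui)\<Delta>\<close>, so every
  divisor of \<open>\<Delta>\<close> divides this point. Conversely \<open>\<Delta> = (a + cn)d - (b + dn)c\<close> for every \<open>n\<close>.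
\<close>

lemma gauss_ints_add: "z \<in> gauss_ints \<Longrightarrow> w \<in> gauss_ints \<Longrightarrow> z + w \<in> gauss_ints"
  by (simp add: gauss_ints_def)

lemma gauss_ints_diff: "z \<in> gauss_ints \<Longrightarrow> w \<in> gauss_ints \<Longrightarrow> z - w \<in> gauss_ints"
  by (simp add: gauss_ints_def)

lemma Complex_of_int_in_gauss_ints: "Complex (of_int m) (of_int n) \<in> gauss_ints"
  by (simp add: gauss_ints_def)

lemma gauss_ints_cases:
  assumes "z \<in> gauss_ints"
  obtains m n where "z = Complex (of_int m) (of_int n)"
proof -
  obtain m n where "Re z = of_int m" "Im z = of_int n"
    using assms by (auto simp: gauss_ints_def elim!: Ints_cases)
  with that show ?thesis by (metis complex.collapse)
qed

lemma gauss_norm_in_Nats: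
  assumes "z \<in> gauss_ints"
  shows "gauss_norm z \<in> \<nat>"
proof -
  have "gauss_norm z \<in> \<int>" "0 \<le> gauss_norm z"
    using assms by (auto simp: gauss_ints_def gauss_norm_def)
  then show ?thesis by (simp add: Nats_altdef2)
qed

lemma gauss_norm_eq_norm: "gauss_norm z = (norm z)\<^sup>2"
  by (simp add: gauss_norm_def cmod_power2)

text \<open>Multiplication by a rational integer acts on the real and imaginary parts separately.
  This turns membership in the rational set into two divisibilities in the integers.\<close>

lemma gauss_dvd_of_int_iff:
  "gauss_dvd (of_int r) (Complex (of_int m) (of_int n)) \<longleftrightarrow> r dvd m \<and> r dvd n"
proof
  assume "gauss_dvd (of_int r) (Complex (of_int m) (of_int n))"
  then obtain q where q: "q \<in> gauss_ints" "Complex (of_int m) (of_int n) = of_int r * q"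
    by (auto simp: gauss_dvd_def)
  obtain x y where "q = Complex (of_int x) (of_int y)"
    using q(1) by (rule gauss_ints_cases)
  with q(2) have "real_of_int m = of_int (r * x)" "real_of_int n = of_int (r * y)"
    by (simp_all add: complex_eq_iff)
  then show "r dvd m \<and> r dvd n"
    unfolding of_int_eq_iff by simp
next
  assume "r dvd m \<and> r dvd n"
  then obtain x y where "m = r * x" "n = r * y" by (auto elim!: dvdE)
  then have "Complex (of_int m) (of_int n) = of_int r * Complex (of_int x) (of_int y)"
    by (simp add: complex_eq_iff)
  then show "gauss_dvd (of_int r) (Complex (of_int m) (of_int n))"
    using Complex_of_int_in_gauss_ints by (auto simp: gauss_dvd_def)
qed

text \<open>Well-ordering of the naturals, transferred to real-valued functions:
  \<open>nat \<lfloor>f y\<rfloor>\<close> loses nothing where \<open>f\<close> takes natural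
  values.\<close>

lemma ex_is_arg_min_Nats:
  fixes f :: "'a \<Rightarrow> real"
  assumes "P x" "\<And>y. P y \<Longrightarrow> f y \<in> \<nat>"
  shows "\<exists>z. is_arg_min f P z"
proof -
  obtain z where z: "P z" "\<And>y. P y \<Longrightarrow> nat \<lfloor>f z\<rfloor> \<le> nat \<lfloor>f y\<rfloor>"
    using ex_has_least_nat[of P x "\<lambda>y. nat \<lfloor>f y\<rfloor>"] assms(1) by blast
  have "f z \<le> f y" if "P y" for y
    using z(2)[OF that] assms(2)[OF that] assms(2)[OF z(1)] by (auto elim!: Nats_cases)
  with z(1) show ?thesis by (auto simp: is_arg_min_def not_less)
qed

text \<open>Distances between Gaussian integers may be irrational, but their squares are natural
  numbers. Minimizing the square is equivalent because squaring is monotone on nonnegative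
  reals.\<close>

lemma is_arg_min_power2_iff:
  fixes f :: "'a \<Rightarrow> real"
  assumes "\<And>x. 0 \<le> f x"
  shows "is_arg_min (\<lambda>x. (f x)\<^sup>2) P z \<longleftrightarrow> is_arg_min f P z"
  using assms by (simp add: is_arg_min_def not_less power_mono_iff)

text \<open>The affine hull of two distinct Gaussian integers on \<open>L\<close> lies in
  \<open>L\<close> and has the same dimension, hence equals \<open>L\<close>. The direction
  \<open>u\<close> is their difference, which need not be the shortest step.\<close>

lemma gaussian_line_cases:
  assumes "gaussian_line L"
  obtains z u where "z \<in> gauss_ints" "u \<in> gauss_ints" "u \<noteq> 0" "L = range (\<lambda>t. z + t *\<^sub>R u)"
proof -
  obtain z w where zw: "z \<in> L \<inter> gauss_ints" "w \<in> L \<inter> gauss_ints" "z \<noteq> w"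
    and L: "affine L" "aff_dim L = 1"
    using assms by (auto simp: gaussian_line_def)
  have "affine hull {z, w} \<subseteq> L"
    using zw L(1) by (simp add: hull_minimal)
  then have "affine hull {z, w} = L"
    using affine_dim_equal[of "affine hull {z, w}" L] L zw by (simp add: aff_dim_2)
  then have "L = range (\<lambda>t. z + t *\<^sub>R (w - z))"
    by (simp add: affine_hull_2_alt)
  with that zw show thesis
    using gauss_ints_diff[of w z] by auto
qed

text \<open>The real point is the midpoint of \<open>p\<close> and \<open>cnj p\<close>. It serves
  to exclude a tie in the choice of \<open>alpha0\<close>.\<close>

lemma affine_cnj_closed_Re:
  assumes "affine L" "p \<in> L" "cnj p \<in> L"
  shows "complex_of_real (Re p) \<in> L"
proof -
  have "(1/2) *\<^sub>R p + (1/2) *\<^sub>R cnj p \<in> L"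
    using assms by (intro mem_affine) auto
  moreover have "(1/2) *\<^sub>R p + (1/2) *\<^sub>R cnj p = complex_of_real (Re p)"
    by (simp add: complex_eq_iff)
  ultimately show ?thesis by simp
qed

text \<open>The description \<open>THE\<close> yields information only once existence and uniqueness
  are known, so both are shown for the norm minimizer with largest real part.\<close>

lemma alpha0_mem:
  assumes "gaussian_line L"
  shows "alpha0 L \<in> L \<inter> gauss_ints"
proof -
  define M where "M = is_arg_min gauss_norm (\<lambda>w. w \<in> L \<inter> gauss_ints)"
  have aff: "affine L" and "\<exists>z. z \<in> L \<inter> gauss_ints"
    using assms by (auto simp: gaussian_line_def)
  then obtain p where p: "M p"
    unfolding M_def using ex_is_arg_min_Nats[of "\<lambda>w. w \<in> L \<inter> gauss_ints" _ gauss_norm]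
    by (meson IntD2 gauss_norm_in_Nats)
  have M_norm: "gauss_norm z = gauss_norm p" if "M z" for z
    using that p by (fastforce simp: M_def is_arg_min_def not_less)
  \<comment> \<open>Maximizing the real part is recast as minimizing a natural number. All
    minimizers share the norm of \<open>p\<close>, and this norm bounds their real parts because m
    \<le> m^2 for every integer m.\<close>
  have "gauss_norm p - Re z \<in> \<nat>" if "M z" for z
  proof -
    have z: "z \<in> gauss_ints" using that by (simp add: M_def is_arg_min_def)
    then obtain m n where mn: "z = Complex (of_int m) (of_int n)" by (rule gauss_ints_cases)
    have "m \<le> m\<^sup>2" using self_le_power[of m 2] by (cases "m \<ge> 1") (auto intro: order.trans[of _ 0])
    then have "real_of_int m \<le> (of_int m)\<^sup>2" by (metis of_int_le_iff of_int_power)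
    then have "Re z \<le> gauss_norm z" by (simp add: mn gauss_norm_def add_increasing2)
    moreover have "gauss_norm z - Re z \<in> \<int>"
      using z by (simp add: gauss_norm_def gauss_ints_def)
    ultimately show ?thesis by (simp add: M_norm[OF that] Nats_altdef2)
  qed
  then obtain q where "is_arg_min (\<lambda>z. gauss_norm p - Re z) M q"
    using ex_is_arg_min_Nats[of M p "\<lambda>z. gauss_norm p - Re z"] p by blast
  then have q: "M q" "\<And>w. M w \<Longrightarrow> Re w \<le> Re q"
    by (auto simp: is_arg_min_def not_less)
  have uniq: "z = q" if z: "M z" "\<And>w. M w \<Longrightarrow> Re w \<le> Re z" for z
  proof (rule ccontr)
    assume "z \<noteq> q"
    have Re: "Re z = Re q" using z q by (simp add: order.antisym)
    have "(Im z)\<^sup>2 = (Im q)\<^sup>2"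
      using M_norm[OF z(1)] M_norm[OF q(1)] Re by (simp add: gauss_norm_def)
    with \<open>z \<noteq> q\<close> Re have "z = cnj q" "Im q \<noteq> 0"
      by (auto simp: complex_eq_iff power2_eq_iff)
    moreover have "q \<in> L \<inter> gauss_ints" "z \<in> L"
      using z(1) q(1) by (simp_all add: M_def is_arg_min_def)
    ultimately have "complex_of_real (Re q) \<in> L \<inter> gauss_ints"
      using affine_cnj_closed_Re[OF aff, of q] by (simp add: gauss_ints_def)
    \<comment> \<open>The real point competes with \<open>q\<close> in the minimization, yet its
      norm is smaller by the square of \<open>Im q\<close>.\<close>
    then have "gauss_norm q \<le> gauss_norm (complex_of_real (Re q))"
      using q(1) by (auto simp: M_def is_arg_min_def not_less)
    with \<open>Im q \<noteq> 0\<close> show False by (simp add: gauss_norm_def)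
  qed
  have "alpha0 L = q"
    unfolding alpha0_def M_def[symmetric] using q uniq by (intro the_equality) blast+
  with q(1) show ?thesis by (simp add: M_def is_arg_min_def)
qed

text \<open>Again the description must be shown to denote. Squared distances are natural numbers,
  which gives existence; a given distance from \<open>alpha0\<close> is attained at most once on
  each side, which gives uniqueness.\<close>

lemma alpha1_is_arg_min:
  assumes "gaussian_line L" "\<not> vertical_line L"
  shows "is_arg_min (\<lambda>w. dist w (alpha0 L))
     (\<lambda>w. w \<in> L \<inter> gauss_ints \<and> Re w > Re (alpha0 L)) (alpha1 L)"
proof -
  let ?a = "alpha0 L"
  let ?P = "\<lambda>w. w \<in> L \<inter> gauss_ints \<and> Re w > Re ?a"
  have a: "?a \<in> L" "?a \<in> gauss_ints" using alpha0_mem[OF assms(1)] by auto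
  obtain z u where zu: "u \<in> gauss_ints" "L = range (\<lambda>t. z + t *\<^sub>R u)"
    using assms(1) by (rule gaussian_line_cases)
  obtain s where s: "?a = z + s *\<^sub>R u" using a zu(2) by auto
  have L_mem: "?a + t *\<^sub>R u \<in> L" for t
  proof -
    have "z + (s + t) *\<^sub>R u \<in> L" using zu(2) by blast
    then show ?thesis by (simp add: s algebra_simps)
  qed
  have L_cases: "\<exists>t. w = ?a + t *\<^sub>R u" if "w \<in> L" for w
  proof -
    obtain t where "w = z + t *\<^sub>R u" using \<open>w \<in> L\<close> zu(2) by blast
    then have "w = ?a + (t - s) *\<^sub>R u" by (simp add: s algebra_simps)
    then show ?thesis ..
  qed
  have "Re u \<noteq> 0"
    using assms(2) by (auto simp: vertical_line_def zu(2))
  \<comment> \<open>The sign of \<open>Re u\<close> orients the step to the right, so there is at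
    least one candidate for \<open>alpha1\<close>.\<close>
  then have "?P (?a + sgn (Re u) *\<^sub>R u)"
    using L_mem zu(1) a(2) by (auto simp: gauss_ints_def sgn_if)
  moreover have "(dist w ?a)\<^sup>2 \<in> \<nat>" if "?P w" for w
    using gauss_norm_in_Nats[OF gauss_ints_diff[of w ?a]] that a(2)
    by (simp add: gauss_norm_eq_norm dist_norm)
  ultimately obtain p where "is_arg_min (\<lambda>w. (dist w ?a)\<^sup>2) ?P p"
    using ex_is_arg_min_Nats[of ?P _ "\<lambda>w. (dist w ?a)\<^sup>2"] by blast
  then have p: "is_arg_min (\<lambda>w. dist w ?a) ?P p"
    by (simp add: is_arg_min_power2_iff)
  have "q = p" if q: "is_arg_min (\<lambda>w. dist w ?a) ?P q" for q
  proof -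
    have "dist q ?a = dist p ?a"
      using p q by (metis (no_types, lifting) is_arg_min_def linorder_less_linear)
    moreover obtain t t' where t: "q = ?a + t *\<^sub>R u" "p = ?a + t' *\<^sub>R u"
      using L_cases p q by (metis (no_types, lifting) IntD1 is_arg_min_def)
    moreover have "u \<noteq> 0" using \<open>Re u \<noteq> 0\<close> by auto
    \<comment> \<open>Both distances are multiples of \<open>norm u\<close>. Lying to the right of
      \<open>alpha0\<close> then forces the two parameters to have the same sign.\<close>
    ultimately have "\<bar>t\<bar> = \<bar>t'\<bar>" by (simp add: dist_norm)
    moreover have "0 < t * Re u" "0 < t' * Re u"
      using p q t by (auto simp: is_arg_min_def)
    ultimately have "t = t'" by (auto simp: abs_eq_iff)
    with t show ?thesis by simp
  qed
  then show ?thesis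
    unfolding alpha1_def using p by (rule theI[where P = "is_arg_min (\<lambda>w. dist w ?a) ?P", rotated])
qed

lemma coprime_delta:
  assumes "gaussian_line L" and delta: "delta L = Complex (of_int c) (of_int d)"
  shows "coprime c d"
proof (cases "vertical_line L")
  case True
  with delta show ?thesis by (simp add: delta_def complex_eq_iff)
next
  case False
  let ?a = "alpha0 L"
  note a = alpha0_mem[OF assms(1)]
  note min = alpha1_is_arg_min[OF assms(1) False]
  have alpha1: "alpha1 L = ?a + Complex (of_int c) (of_int d)"
    using delta False by (simp add: delta_def algebra_simps)
  \<comment> \<open>Since \<open>c\<close> is positive, the gcd is nonzero and the divided step
    still points to the right.\<close>
  have "0 < c" and "alpha1 L \<in> L"
    using min alpha1 by (auto simp: is_arg_min_def)
  define g where "g = gcd c d"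
  obtain c' d' where cd: "c = g * c'" "d = g * d'"
    unfolding g_def by (meson dvdE gcd_dvd1 gcd_dvd2)
  have "0 < g" using \<open>0 < c\<close> by (simp add: g_def)
  with \<open>0 < c\<close> have "0 < c'" by (simp add: cd zero_less_mult_iff)
  let ?u = "Complex (of_int c') (of_int d')"
  have step: "alpha1 L - ?a = of_int g *\<^sub>R ?u"
    by (simp add: alpha1 cd complex_eq_iff)
  \<comment> \<open>This affine combination is the point one g-th of the way from
    \<open>alpha0\<close> to \<open>alpha1\<close>, that is, \<open>?a + ?u\<close>.\<close>
  have "(1 - 1 / of_int g) *\<^sub>R ?a + (1 / of_int g) *\<^sub>R alpha1 L \<in> L"
    using assms(1) a \<open>alpha1 L \<in> L\<close> by (intro mem_affine) (auto simp: gaussian_line_def)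
  moreover have "alpha1 L = ?a + of_int g *\<^sub>R ?u"
    using step by (simp add: algebra_simps)
  ultimately have "?a + ?u \<in> L"
    using \<open>0 < g\<close> by (simp add: algebra_simps)
  moreover have "?a + ?u \<in> gauss_ints"
    using a by (simp add: gauss_ints_add Complex_of_int_in_gauss_ints)
  ultimately have "dist (alpha1 L) ?a \<le> dist (?a + ?u) ?a"
    using min \<open>0 < c'\<close> by (force simp: is_arg_min_def not_less)
  then have "of_int g * norm ?u \<le> norm ?u"
    using \<open>0 < g\<close> by (simp add: dist_norm step)
  moreover have "0 < norm ?u"
    using \<open>0 < c'\<close> by (simp add: complex_eq_iff)
  ultimately have "g \<le> 1" by simp
  with \<open>0 < g\<close> have "g = 1" by linarith
  then show ?thesis by (simp add: g_def coprime_iff_gcd_eq_1)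
qed

theorem theorem4:
  fixes L :: "complex set" and a b c d r :: int
  assumes "primitive_line L"
    and "alpha0 L = Complex (of_int a) (of_int b)"
    and "delta L = Complex (of_int c) (of_int d)"
  shows "r \<in> rational_set L \<longleftrightarrow> r dvd (a * d - b * c)"
proof -
  have "alpha L n = Complex (of_int (a + c * n)) (of_int (b + d * n))" for n
    by (simp add: alpha_def assms(2,3) complex_eq_iff)
  then have mem: "r \<in> rational_set L \<longleftrightarrow> (\<exists>n. r dvd a + c * n \<and> r dvd b + d * n)"
    unfolding rational_set_def mem_Collect_eq by (simp only: gauss_dvd_of_int_iff)
  show ?thesis
    unfolding mem
  proof
    assume "\<exists>n. r dvd a + c * n \<and> r dvd b + d * n"
    then obtain n where "r dvd (a + c * n) * d - (b + d * n) * c"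
      by (meson dvd_diff dvd_mult2)
    then show "r dvd a * d - b * c" by (simp add: algebra_simps)
  next
    assume r: "r dvd a * d - b * c"
    have "coprime c d"
      using coprime_delta[OF _ assms(3)] assms(1) by (simp add: primitive_line_def)
    then obtain u v where uv: "u * c + v * d = 1"
      by (metis bezout_int coprime_iff_gcd_eq_1)
    \<comment> \<open>Replace \<open>a\<close> by a(uc + vd) and \<open>b\<close> by b(uc + vd): the
      terms in u cancel in the first identity, those in v in the second.\<close>
    have "a + c * - (u * a + v * b) = v * (a * d - b * c)"
      and "b + d * - (u * a + v * b) = - u * (a * d - b * c)"
      using uv by algebra+
    with r show "\<exists>n. r dvd a + c * n \<and> r dvd b + d * n"
      by (metis dvd_mult)
  qed
qed

end
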